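(* Let $B_1=\{231,312,1432\}$. For every positive integer $n$ and every nonnegative integer $k$, the number of permutations in $\operatorname{Av}_n(B_1)$ with exactly $k$ inversions is $$\sum_{\ell=1}^{n}\binom{n-\ell-\left(k-\binom{\ell}{2}\right)}{k-\binom{\ell}{2}}.$$
   Context: $\operatorname{Av}_n(S)$ is the set of permutations of length $n$ avoiding every pattern in $S$ (classical pattern avoidance). An inversion of a permutation $\pi$ is a pair of positions $i<j$ with $\pi_i>\pi_j$. Binomial coefficients $\binom{a}{b}$ with integer arguments are taken to be $0$ unless $0\le b\le a$. *)

theory Defs
  imports Main "HOL-Library.Sublist" "HOL-Combinatorics.Multiset_Permutations"
begin

(* A permutation of length n is its one-line notation: a list in permutations_of_set {1..n}.
   Patterns are permutations in the same notation, so 231 is [2, 3, 1].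
   List positions count from 0. *)

definition order_isomorphic :: "nat list \<Rightarrow> nat list \<Rightarrow> bool" where
  "order_isomorphic xs ys \<longleftrightarrow>
     length xs = length ys \<and>
     (\<forall>i<length xs. \<forall>j<length xs. xs ! i < xs ! j \<longleftrightarrow> ys ! i < ys ! j)"

definition contains_pattern :: "nat list \<Rightarrow> nat list \<Rightarrow> bool" where
  "contains_pattern p s \<longleftrightarrow> (\<exists>ys. subseq ys p \<and> order_isomorphic ys s)"

definition Av :: "nat \<Rightarrow> nat list set \<Rightarrow> nat list set" where
  "Av n S = {p \<in> permutations_of_set {1..n}. \<forall>s\<in>S. \<not> contains_pattern p s}"

definition inversions :: "nat list \<Rightarrow> (nat \<times> nat) set" where
  "inversions p = {(i, j). i < j \<and> j < length p \<and> p ! i > p ! j}"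

(* Integer arguments are needed: truncated subtraction on nat would turn a negative
   lower argument into 0 and the coefficient into 1. *)
definition int_binomial :: "int \<Rightarrow> int \<Rightarrow> nat" where
  "int_binomial a b = (if 0 \<le> b \<and> b \<le> a then nat a choose nat b else 0)"

definition B1 :: "nat list set" where
  "B1 = {[2, 3, 1], [3, 1, 2], [1, 4, 3, 2]}"

end

theory Submission
  imports Defs
begin

text \<open>
  A permutation avoiding 231 and 312 is a direct sum of decreasing blocks: the values below its
  first entry must occur in decreasing order, and before all larger ones. Avoiding 1432 then says
  that every block except the first has size 1 or 2. With a first block of size \<open>l\<close> and \<open>j\<close> further
  blocks of size 2 there are \<open>l choose 2\<close> plus \<open>j\<close> inversions, and the blocks after the first are
  arranged in \<open>n - l - j choose j\<close> ways.
\<close>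

section \<open>Patterns as inequalities on subsequences\<close>

lemma order_isomorphicD:
  assumes "order_isomorphic xs ys" "i < length ys" "j < length ys" "ys ! i < ys ! j"
  shows "xs ! i < xs ! j"
  using assms unfolding order_isomorphic_def by metis

text \<open>Comparing values that are consecutive in the pattern suffices; the remaining comparisons
  follow by transitivity. The other two patterns are treated in the same way.\<close>

lemma order_isomorphic_231_iff:
  "order_isomorphic ys [2, 3, 1] \<longleftrightarrow> (\<exists>x y z. ys = [x, y, z] \<and> z < x \<and> x < y)"
proof
  assume iso: "order_isomorphic ys [2, 3, 1]"
  then have "length ys = Suc (Suc (Suc 0))" unfolding order_isomorphic_def by simp
  then obtain x y z where "ys = [x, y, z]" unfolding length_Suc_conv by blast
  then show "\<exists>x y z. ys = [x, y, z] \<and> z < x \<and> x < y"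
    using order_isomorphicD[OF iso, of 2 0] order_isomorphicD[OF iso, of 0 1] by simp
next
  assume "\<exists>x y z. ys = [x, y, z] \<and> z < x \<and> x < y"
  then obtain x y z where ys: "ys = [x, y, z]" and less: "z < x" "x < y" by blast
  moreover from less have "z < y" by simp
  ultimately show "order_isomorphic ys [2, 3, 1]"
    unfolding order_isomorphic_def ys by (simp add: All_less_Suc)
qed

lemma order_isomorphic_312_iff:
  "order_isomorphic ys [3, 1, 2] \<longleftrightarrow> (\<exists>x y z. ys = [x, y, z] \<and> y < z \<and> z < x)"
proof
  assume iso: "order_isomorphic ys [3, 1, 2]"
  then have "length ys = Suc (Suc (Suc 0))" unfolding order_isomorphic_def by simp
  then obtain x y z where "ys = [x, y, z]" unfolding length_Suc_conv by blast
  then show "\<exists>x y z. ys = [x, y, z] \<and> y < z \<and> z < x"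
    using order_isomorphicD[OF iso, of 1 2] order_isomorphicD[OF iso, of 2 0] by simp
next
  assume "\<exists>x y z. ys = [x, y, z] \<and> y < z \<and> z < x"
  then obtain x y z where ys: "ys = [x, y, z]" and less: "y < z" "z < x" by blast
  moreover from less have "y < x" by simp
  ultimately show "order_isomorphic ys [3, 1, 2]"
    unfolding order_isomorphic_def ys by (simp add: All_less_Suc)
qed

lemma order_isomorphic_1432_iff:
  "order_isomorphic ys [1, 4, 3, 2] \<longleftrightarrow>
    (\<exists>w x y z. ys = [w, x, y, z] \<and> w < z \<and> z < y \<and> y < x)"
proof
  assume iso: "order_isomorphic ys [1, 4, 3, 2]"
  then have "length ys = Suc (Suc (Suc (Suc 0)))" unfolding order_isomorphic_def by simp
  then obtain w x y z where "ys = [w, x, y, z]" unfolding length_Suc_conv by blast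
  then show "\<exists>w x y z. ys = [w, x, y, z] \<and> w < z \<and> z < y \<and> y < x"
    using order_isomorphicD[OF iso, of 0 3] order_isomorphicD[OF iso, of 3 2]
      order_isomorphicD[OF iso, of 2 1] by simp
next
  assume "\<exists>w x y z. ys = [w, x, y, z] \<and> w < z \<and> z < y \<and> y < x"
  then obtain w x y z where ys: "ys = [w, x, y, z]" and less: "w < z" "z < y" "y < x" by blast
  moreover from less have "w < y" "w < x" "z < x" by simp_all
  ultimately show "order_isomorphic ys [1, 4, 3, 2]"
    unfolding order_isomorphic_def ys by (simp add: All_less_Suc)
qed

lemma contains_231_iff:
  "contains_pattern p [2, 3, 1] \<longleftrightarrow> (\<exists>x y z. subseq [x, y, z] p \<and> z < x \<and> x < y)"
  unfolding contains_pattern_def order_isomorphic_231_iff by blast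

lemma contains_312_iff:
  "contains_pattern p [3, 1, 2] \<longleftrightarrow> (\<exists>x y z. subseq [x, y, z] p \<and> y < z \<and> z < x)"
  unfolding contains_pattern_def order_isomorphic_312_iff by blast

lemma contains_1432_iff:
  "contains_pattern p [1, 4, 3, 2] \<longleftrightarrow>
    (\<exists>w x y z. subseq [w, x, y, z] p \<and> w < z \<and> z < y \<and> y < x)"
  unfolding contains_pattern_def order_isomorphic_1432_iff by blast

lemma contains_pattern_mono: "contains_pattern v s \<Longrightarrow> subseq v p \<Longrightarrow> contains_pattern p s"
  unfolding contains_pattern_def using subseq_order.trans by blast

section \<open>Splitting off the first decreasing block\<close>

lemma filter_partition_append:
  assumes "\<And>y z. subseq [y, z] r \<Longrightarrow> \<not> P y \<Longrightarrow> \<not> P z"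
  shows "r = filter P r @ filter (\<lambda>y. \<not> P y) r"
  using assms
proof (induction r)
  case (Cons u r)
  have IH: "r = filter P r @ filter (\<lambda>y. \<not> P y) r"
    by (rule Cons.IH) (meson Cons.prems list_emb_Cons)
  show ?case
  proof (cases "P u")
    case False
    then have "\<forall>z\<in>set r. \<not> P z"
      using Cons.prems[of u] by (simp add: subseq_singleton_left)
    then show ?thesis using False by (simp add: filter_empty_conv)
  qed (use IH[symmetric] in simp)
qed simp

lemma subseq_imp_subset: "subseq xs ys \<Longrightarrow> set xs \<subseteq> set ys"
  by (auto simp: subseq_conv_nths dest: in_set_nthsD)

lemma subseq_imp_distinct: "subseq xs ys \<Longrightarrow> distinct ys \<Longrightarrow> distinct xs"
  by (auto simp: subseq_conv_nths)

text \<open>This links the two languages of the proof: avoidance speaks of subsequences, the shape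
  of a block of \<open>sorted_wrt\<close>. It is used in both directions.\<close>

lemma sorted_wrt_iff_subseq: "sorted_wrt R s \<longleftrightarrow> (\<forall>y z. subseq [y, z] s \<longrightarrow> R y z)"
proof (induction s)
  case (Cons u s)
  have "subseq [y, z] (u # s) \<longleftrightarrow> y = u \<and> z \<in> set s \<or> subseq [y, z] s" for y z
    using subseq_Cons'[of y "[z]" s] by (auto simp: subseq_singleton_left)
  then show ?case using Cons by auto
qed simp

text \<open>A strictly decreasing list is determined by its set of entries; reversal reduces this to
  the uniqueness of sorted distinct lists.\<close>

lemma sorted_wrt_greater_eq_rev_upt:
  assumes "sorted_wrt (>) s" "set s = {a<..<x}"
  shows "s = rev [Suc a..<x]"
proof -
  have "sorted_wrt (<) (rev s)" using assms(1) by (simp only: sorted_wrt_rev)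
  then have sorted_rev: "sorted (rev s)" and distinct_rev: "distinct (rev s)"
    unfolding strict_sorted_iff by blast+
  have "set (rev s) = set [Suc a..<x]"
    using assms(2) by (simp add: atLeastSucLessThan_greaterThanLessThan)
  then have "rev s = [Suc a..<x]"
    by (rule sorted_distinct_set_unique[OF sorted_rev distinct_rev sorted_upt distinct_upt])
  then show ?thesis by (metis rev_rev_ident)
qed

text \<open>Let \<open>x\<close> be the first entry. A smaller entry after a larger one would
  complete a 231 with \<open>x\<close>, and an ascent among the smaller entries would complete a
  312. Hence \<open>p\<close> begins by descending from \<open>x\<close> to \<open>Suc a\<close>.
  The values form an arbitrary interval so that the lemma applies again to the remainder
  \<open>v\<close>.\<close>

lemma first_layer:
  assumes "distinct p" "set p = {a<..b}" "a < b"
    and "\<not> contains_pattern p [2, 3, 1]" "\<not> contains_pattern p [3, 1, 2]"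
  obtains x v where "a < x" "x \<le> b" "p = rev [Suc a..<Suc x] @ v" "distinct v" "set v = {x<..b}"
proof -
  obtain x r where p: "p = x # r" using assms(2,3) by (cases p) auto
  have "x \<in> {a<..b}" unfolding assms(2)[symmetric] p by simp
  then have x: "a < x" "x \<le> b" by simp_all
  have r: "distinct r" "x \<notin> set r" using assms(1) p by auto
  have set_r: "set r = {a<..b} - {x}" unfolding assms(2)[symmetric] p using r by auto
  define s v where s_def: "s = filter (\<lambda>y. y < x) r" and v_def: "v = filter (\<lambda>y. \<not> y < x) r"
  \<comment> \<open>The two filters preserve order only within each part; avoiding 231 shows that
    they merely cut \<open>r\<close> at one point.\<close>
  have "r = s @ v"
    unfolding s_def v_def
  proof (rule filter_partition_append)
    fix y z assume yz: "subseq [y, z] r" "\<not> y < x"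
    then have "y \<in> set r" using subseq_imp_subset[OF yz(1)] by simp
    then have "x < y" using yz r by (metis linorder_cases)
    moreover have "subseq [x, y, z] p" using yz p by simp
    ultimately show "\<not> z < x" using assms(4) contains_231_iff by blast
  qed
  have "sorted_wrt (>) s"
    unfolding sorted_wrt_iff_subseq
  proof (intro allI impI)
    fix y z assume yz: "subseq [y, z] s"
    then have "set [y, z] \<subseteq> set s" by (rule subseq_imp_subset)
    then have lt: "y < x" "z < x" by (auto simp: s_def)
    have "subseq [y, z] r"
      using yz unfolding s_def by (rule subseq_order.trans) (rule subseq_filter_left)
    then have "subseq [x, y, z] p" using p by simp
    then have "\<not> y < z" using assms(5) contains_312_iff lt by blast
    moreover have "y \<noteq> z" using yz r(1) subseq_imp_distinct[of "[y, z]" s] by (auto simp: s_def)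
    ultimately show "y > z" by simp
  qed
  moreover have "set s = {a<..<x}" unfolding s_def set_filter set_r using x by auto
  ultimately have "s = rev [Suc a..<x]" by (rule sorted_wrt_greater_eq_rev_upt)
  then have "p = rev [Suc a..<Suc x] @ v" using p \<open>r = s @ v\<close> x by simp
  moreover have "set v = {x<..b}" unfolding v_def set_filter set_r using x by auto
  ultimately show thesis using that x r by (simp add: v_def)
qed

section \<open>Sequences of blocks of size 1 and 2\<close>

text \<open>Blocks of size 1 (\<open>False\<close>) and 2 (\<open>True\<close>) on the values above \<open>a\<close>.\<close>

fun short_layers :: "nat \<Rightarrow> bool list \<Rightarrow> nat list" where
  "short_layers a [] = []"
| "short_layers a (False # c) = Suc a # short_layers (Suc a) c"
| "short_layers a (True # c) = Suc (Suc a) # Suc a # short_layers (Suc (Suc a)) c"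

text \<open>Each block counts once in \<open>length c\<close>, and each block of size 2 once more.
  Given the total size, the number of \<open>True\<close> entries fixes the length, so that counting
  becomes a choice of positions.\<close>

abbreviation layers_size :: "bool list \<Rightarrow> nat" where
  "layers_size c \<equiv> length c + count_list c True"

lemma set_short_layers: "set (short_layers a c) = {a<..a + layers_size c}"
  by (induction a c rule: short_layers.induct) auto

lemma distinct_short_layers: "distinct (short_layers a c)"
  by (induction a c rule: short_layers.induct) (auto simp: set_short_layers)

text \<open>The first entry, \<open>Suc a\<close> or \<open>Suc (Suc a)\<close>, reveals the size of
  the first block.\<close>

lemma short_layers_inject: "short_layers a c = short_layers a d \<Longrightarrow> c = d"
proof (induction a c arbitrary: d rule: short_layers.induct)
  case (1 a)
  then show ?case by (cases "(a, d)" rule: short_layers.cases) auto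
next
  case (2 a c)
  then show ?case by (cases "(a, d)" rule: short_layers.cases) auto
next
  case (3 a c)
  then show ?case by (cases "(a, d)" rule: short_layers.cases) auto
qed

text \<open>The blocks ascend, so the only inverted entries are the two consecutive values inside a
  block of size 2.\<close>

lemma short_layers_descent: "sorted_wrt (\<lambda>y z. y < z \<or> y = Suc z) (short_layers a c)"
  by (induction a c rule: short_layers.induct) (auto simp: set_short_layers)

text \<open>Induction on the length of the interval: \<open>first_layer\<close> peels off a block,
  and a block of size 3 or more would contain a decreasing triple. The last hypothesis is what
  avoiding 1432 becomes behind the first block.\<close>

lemma short_layers_exists:
  assumes "distinct p" "set p = {a<..b}" "a \<le> b"
    and "\<not> contains_pattern p [2, 3, 1]" "\<not> contains_pattern p [3, 1, 2]"
    and "\<And>x y z. subseq [x, y, z] p \<Longrightarrow> \<not> (z < y \<and> y < x)"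
  shows "\<exists>c. p = short_layers a c"
  using assms
proof (induction "b - a" arbitrary: a p rule: less_induct)
  case less
  show ?case
  proof (cases "a = b")
    case True
    then have "p = short_layers a []" using less.prems by simp
    then show ?thesis by blast
  next
    case False
    then obtain x v where xv: "a < x" "x \<le> b" "p = rev [Suc a..<Suc x] @ v"
        "distinct v" "set v = {x<..b}"
      using first_layer less.prems by (metis le_neq_implies_less)
    have sub: "subseq v p" unfolding xv(3) by (rule subseq_drop_many) simp
    have "\<exists>c. v = short_layers x c"
    proof (rule less.hyps)
      show "\<not> contains_pattern v [2, 3, 1]" "\<not> contains_pattern v [3, 1, 2]"
        using less.prems(4,5) sub contains_pattern_mono by blast+
      show "\<not> (z' < y \<and> y < x')" if "subseq [x', y, z'] v" for x' y z'
        using less.prems(6) that sub subseq_order.trans by blast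
    qed (use xv in auto)
    then obtain c where c: "v = short_layers x c" by blast
    have "x \<le> Suc (Suc a)"
    proof (rule ccontr)
      assume "\<not> x \<le> Suc (Suc a)"
      \<comment> \<open>The bound \<open>e >= a\<close> keeps \<open>Suc e\<close>, the third
        largest value, inside the block, whose least value is \<open>Suc a\<close>.\<close>
      then obtain e where e: "x = Suc (Suc (Suc e))" "e \<ge> a"
        by (metis Suc_le_D Suc_le_mono not_less_eq_eq)
      then have "subseq [x, Suc (Suc e), Suc e] p"
        using xv(3) by (simp add: list_emb_append2)
      then show False using less.prems(6) e by fastforce
    qed
    then consider "x = Suc a" | "x = Suc (Suc a)" using xv(1) by linarith
    then show ?thesis
    proof cases
      case 1
      then have "p = short_layers a (False # c)" using xv(3) c by simp
      then show ?thesis by blast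
    next
      case 2
      then have "p = short_layers a (True # c)" using xv(3) c by simp
      then show ?thesis by blast
    qed
  qed
qed

section \<open>Layered permutations are exactly the avoiders\<close>

definition layered :: "nat \<Rightarrow> bool list \<Rightarrow> nat list" where
  "layered l c = rev [1..<Suc l] @ short_layers l c"

lemma set_layered: "set (layered l c) = {1..l + layers_size c}"
  by (auto simp: layered_def set_short_layers)

lemma distinct_layered: "distinct (layered l c)"
  by (auto simp: layered_def set_short_layers distinct_short_layers)

text \<open>The alternatives are the possible positions of \<open>y\<close> before \<open>z\<close>:
  both in the first block, in different blocks, or together in a later block of size 2. All three
  patterns are refuted from this relation alone.\<close>

lemma layered_descent:
  "sorted_wrt (\<lambda>y z. y \<le> l \<and> z < y \<or> y < z \<and> l < z \<or> l < z \<and> y = Suc z) (layered l c)"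
    (is "sorted_wrt ?R _")
  unfolding layered_def sorted_wrt_append
proof (intro conjI)
  have "sorted_wrt (<) [1..<Suc l]" by (rule sorted_wrt_upt)
  then have "sorted_wrt (>) (rev [1..<Suc l])" by (simp only: sorted_wrt_rev)
  then show "sorted_wrt ?R (rev [1..<Suc l])"
    by (rule sorted_wrt_mono_rel[rotated]) auto
  show "sorted_wrt ?R (short_layers l c)"
    by (rule sorted_wrt_mono_rel[OF _ short_layers_descent]) (auto simp: set_short_layers)
qed (auto simp: set_short_layers)

lemma layered_avoids:
  assumes "s \<in> B1"
  shows "\<not> contains_pattern (layered l c) s"
proof -
  have pair: "y \<le> l \<and> z < y \<or> y < z \<and> l < z \<or> l < z \<and> y = Suc z"
    if "subseq [y, z] (layered l c)" for y z
    using layered_descent that unfolding sorted_wrt_iff_subseq by blast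
  have False if "subseq [x, y, z] (layered l c)" "z < x \<and> x < y \<or> y < z \<and> z < x" for x y z
  proof -
    have "subseq [x, y] [x, y, z]" "subseq [x, z] [x, y, z]" "subseq [y, z] [x, y, z]" by auto
    then have "subseq [x, y] (layered l c)" "subseq [x, z] (layered l c)" "subseq [y, z] (layered l c)"
      using that(1) subseq_order.trans by blast+
    \<comment> \<open>The ascent forces the largest of the three values above \<open>l\<close>.
      Every smaller entry after it must then be its immediate predecessor, which neither pattern
      permits.\<close>
    then show False using pair[of x y] pair[of x z] pair[of y z] that(2) by linarith
  qed
  then have "\<not> contains_pattern (layered l c) [2, 3, 1]" "\<not> contains_pattern (layered l c) [3, 1, 2]"
    unfolding contains_231_iff contains_312_iff by blast+
  moreover have False if "subseq [w, x, y, z] (layered l c)" "w < z" "z < y" "y < x" for w x y z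
  proof -
    have "subseq [w, z] [w, x, y, z]" "subseq [x, z] [w, x, y, z]" by auto
    then have "subseq [w, z] (layered l c)" "subseq [x, z] (layered l c)"
      using that(1) subseq_order.trans by blast+
    \<comment> \<open>The ascent \<open>w < z\<close> puts \<open>z\<close> above \<open>l\<close>,
      so \<open>x\<close> is above \<open>l\<close> too; then \<open>x = Suc z\<close>, leaving no
      room for \<open>y\<close>.\<close>
    then show False using pair[of w z] pair[of x z] that by linarith
  qed
  then have "\<not> contains_pattern (layered l c) [1, 4, 3, 2]"
    unfolding contains_1432_iff by blast
  ultimately show ?thesis using assms unfolding B1_def by blast
qed

text \<open>For the harder inclusion, \<open>first_layer\<close> finds the first block, of any size,
  and \<open>short_layers_exists\<close> decomposes what follows it.\<close>

lemma Av_B1_eq: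
  assumes "n \<ge> 1"
  shows "Av n B1 = {layered l c | l c. 1 \<le> l \<and> l + layers_size c = n}"
proof (intro equalityI subsetI)
  fix p assume "p \<in> {layered l c | l c. 1 \<le> l \<and> l + layers_size c = n}"
  then show "p \<in> Av n B1"
    using layered_avoids
    by (auto simp: Av_def permutations_of_set_def set_layered distinct_layered)
next
  fix p assume "p \<in> Av n B1"
  then have "distinct p" "set p = {1..n}" and avoid: "\<forall>s\<in>B1. \<not> contains_pattern p s"
    by (simp_all add: Av_def permutations_of_set_def)
  moreover have "{1..n} = {0<..n}" by auto
  ultimately have p: "distinct p" "set p = {0<..n}" by simp_all
  have patterns: "\<not> contains_pattern p [2, 3, 1]" "\<not> contains_pattern p [3, 1, 2]"
      "\<not> contains_pattern p [1, 4, 3, 2]"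
    using avoid unfolding B1_def by blast+
  have "0 < n" using assms by simp
  then obtain l v where lv: "0 < l" "l \<le> n" "p = rev [Suc 0..<Suc l] @ v"
      "distinct v" "set v = {l<..n}"
    using first_layer[of p 0 n, OF p _ patterns(1,2)] by blast
  have sub: "subseq v p" unfolding lv(3) by (rule subseq_drop_many) simp
  have "\<exists>c. v = short_layers l c"
  proof (rule short_layers_exists)
    show "\<not> contains_pattern v [2, 3, 1]" "\<not> contains_pattern v [3, 1, 2]"
      using patterns(1,2) sub contains_pattern_mono by blast+
    show "\<not> (z < y \<and> y < x)" if "subseq [x, y, z] v" for x y z
    proof
      assume less: "z < y \<and> y < x"
      have "z \<in> set v" using subseq_imp_subset[OF that] by simp
      then have "l < z" using lv(5) by simp
      \<comment> \<open>The first entry \<open>l\<close> plays the 1 of 1432, since everything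
        behind the first block lies above it.\<close>
      moreover have "subseq [l, x, y, z] p"
        using lv(1,3) that by (simp add: list_emb_append2)
      ultimately show False using patterns(3) less unfolding contains_1432_iff by blast
    qed
  qed (use lv in auto)
  then obtain c where c: "v = short_layers l c" by blast
  then have "{l<..l + layers_size c} = {l<..n}" using lv(5) by (simp add: set_short_layers)
  \<comment> \<open>Cardinalities give equality of the endpoints even if both intervals are
    empty.\<close>
  then have "card {l<..l + layers_size c} = card {l<..n}" by (rule arg_cong)
  then have "l + layers_size c = n" using lv(2) by simp
  moreover have "p = layered l c" using lv(3) c by (simp add: layered_def)
  moreover have "1 \<le> l" using lv(1) by simp
  ultimately show "p \<in> {layered l c | l c. 1 \<le> l \<and> l + layers_size c = n}"
    using \<open>1 \<le> l\<close> by blast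
qed

section \<open>Counting inversions\<close>

lemma finite_inversions: "finite (inversions p)"
  by (rule finite_subset[of _ "{..<length p} \<times> {..<length p}"]) (auto simp: inversions_def)

text \<open>Pairs of positions split by whether the first one is 0; the others are the inversions of
  \<open>xs\<close> with both positions shifted by one.\<close>

lemma card_inversions_Cons:
  "card (inversions (x # xs)) = length (filter (\<lambda>y. y < x) xs) + card (inversions xs)"
proof -
  let ?A = "{i. i < length xs \<and> xs ! i < x}"
  have "inversions (x # xs) = (\<lambda>i. (0, Suc i)) ` ?A \<union> map_prod Suc Suc ` inversions xs"
  proof (intro equalityI subsetI)
    fix q assume "q \<in> inversions (x # xs)"
    then obtain i j where q: "q = (i, Suc j)" "i < Suc j" "j < length xs" "(x # xs) ! i > xs ! j"
      by (auto simp: inversions_def gr0_conv_Suc elim!: less_natE)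
    then show "q \<in> (\<lambda>i. (0, Suc i)) ` ?A \<union> map_prod Suc Suc ` inversions xs"
      by (cases i) (force simp: inversions_def)+
  qed (auto simp: inversions_def)
  moreover have "card ((\<lambda>i. (0 :: nat, Suc i)) ` ?A \<union> map_prod Suc Suc ` inversions xs)
      = card ((\<lambda>i. (0 :: nat, Suc i)) ` ?A) + card (map_prod Suc Suc ` inversions xs)"
    by (rule card_Un_disjoint) (auto simp: finite_inversions)
  moreover have "card ((\<lambda>i. (0 :: nat, Suc i)) ` ?A) = length (filter (\<lambda>y. y < x) xs)"
    by (simp add: card_image inj_on_def length_filter_conv_card)
  moreover have "card (map_prod Suc Suc ` inversions xs) = card (inversions xs)"
    by (intro card_image inj_onI) auto
  ultimately show ?thesis by simp
qed

lemma card_inversions_append: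
  assumes "\<forall>y\<in>set u. \<forall>z\<in>set v. y < z"
  shows "card (inversions (u @ v)) = card (inversions u) + card (inversions v)"
  using assms
proof (induction u)
  case (Cons y u)
  then have "filter (\<lambda>z. z < y) v = []" by (force simp: filter_empty_conv)
  then show ?case using Cons by (simp add: card_inversions_Cons)
qed (simp add: inversions_def)

text \<open>Prepending \<open>Suc l\<close> adds \<open>l\<close> inversions, in accordance with
  Pascal's rule for \<open>l choose 2\<close>.\<close>

lemma card_inversions_rev_upt: "card (inversions (rev [1..<Suc l])) = l choose 2"
proof (induction l)
  case (Suc l)
  have "filter (\<lambda>y. y < Suc l) (rev [1..<Suc l]) = rev [1..<Suc l]"
    by (subst filter_True) auto
  then show ?case
    using Suc by (simp add: card_inversions_Cons numeral_2_eq_2)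
qed (simp add: inversions_def)

lemma card_inversions_short_layers: "card (inversions (short_layers a c)) = count_list c True"
proof (induction a c rule: short_layers.induct)
  case (1 a)
  then show ?case by (simp add: inversions_def)
next
  case (2 a c)
  have "filter (\<lambda>y. y < Suc a) (short_layers (Suc a) c) = []"
    by (auto simp: filter_empty_conv set_short_layers)
  then show ?case using 2 by (simp add: card_inversions_Cons)
next
  case (3 a c)
  have "filter (\<lambda>y. y < e) (short_layers (Suc (Suc a)) c) = []" if "e \<le> Suc (Suc a)" for e
    using that by (auto simp: filter_empty_conv set_short_layers)
  then show ?case using 3 by (simp add: card_inversions_Cons)
qed

lemma card_inversions_layered:
  "card (inversions (layered l c)) = (l choose 2) + count_list c True"
proof -
  have "card (inversions (layered l c))
      = card (inversions (rev [1..<Suc l])) + card (inversions (short_layers l c))"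
    unfolding layered_def by (rule card_inversions_append) (auto simp: set_short_layers)
  then show ?thesis
    by (simp only: card_inversions_rev_upt card_inversions_short_layers)
qed

section \<open>Counting the parameters of layered permutations\<close>

lemma layered_inject:
  assumes "layered l c = layered m d" "1 \<le> l" "1 \<le> m"
  shows "l = m \<and> c = d"
proof -
  \<comment> \<open>A nonempty first block starts with its own size. An empty one would destroy
    uniqueness: \<open>layered 0 (False # e)\<close> equals \<open>layered 1 e\<close>.\<close>
  have "hd (layered i e) = i" if "1 \<le> i" for i e using that by (cases i) (auto simp: layered_def)
  then have "l = m" using assms by metis
  then show ?thesis using assms(1) short_layers_inject by (simp add: layered_def)
qed

text \<open>Splitting by the first entry gives Pascal's rule. Finiteness is carried through the
  induction because the cardinality of the disjoint union requires it.\<close>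

lemma card_bool_lists:
  "finite {c. length c = N \<and> count_list c True = j}
    \<and> card {c. length c = N \<and> count_list c True = j} = N choose j"
proof (induction N arbitrary: j)
  case 0
  have "{c. length c = 0 \<and> count_list c True = j} = (if j = 0 then {[]} else {})" by auto
  then show ?case by simp
next
  case (Suc N)
  let ?S = "\<lambda>N j. {c. length c = N \<and> count_list c True = j}"
  show ?case
  proof (cases j)
    case 0
    have "?S (Suc N) j = (#) False ` ?S N 0"
      unfolding 0 by (auto simp: length_Suc_conv split: if_splits)
    then show ?thesis using Suc 0 by (simp add: card_image)
  next
    case j: (Suc i)
    have eq: "?S (Suc N) j = (#) False ` ?S N j \<union> (#) True ` ?S N i"
      unfolding j by (auto simp: length_Suc_conv split: if_splits)
    have "card ((#) False ` ?S N j \<union> (#) True ` ?S N i)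
        = card ((#) False ` ?S N j) + card ((#) True ` ?S N i)"
      by (rule card_Un_disjoint) (use Suc in auto)
    then show ?thesis unfolding eq using Suc j by (simp add: card_image)
  qed
qed

text \<open>With \<open>j = k - t\<close> blocks of size 2 the list has length \<open>m - j\<close>,
  so \<open>card_bool_lists\<close> applies. If \<open>k < t\<close> or \<open>k - t > m\<close>, no
  list exists, and \<open>int_binomial\<close> is 0 because its lower or upper argument,
  respectively, is negative.\<close>

lemma card_layers_of_size:
  "finite {c. layers_size c = m \<and> t + count_list c True = k} \<and>
   card {c. layers_size c = m \<and> t + count_list c True = k}
    = int_binomial (int m - (int k - int t)) (int k - int t)"
proof (cases "t \<le> k \<and> k - t \<le> m")
  case True
  define j where "j = k - t"
  have k: "k = t + j" "j \<le> m" using True by (auto simp: j_def)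
  have "{c. layers_size c = m \<and> t + count_list c True = k}
      = {c. length c = m - j \<and> count_list c True = j}"
    using k by auto
  \<comment> \<open>If \<open>j > m - j\<close>, the explicit 0 of \<open>int_binomial\<close>
    agrees with the value of \<open>choose\<close>.\<close>
  moreover have "int_binomial (int m - (int k - int t)) (int k - int t) = (m - j) choose j"
    using k by (auto simp: int_binomial_def nat_diff_distrib binomial_eq_0)
  ultimately show ?thesis using card_bool_lists by simp
next
  case False
  then have "{c. layers_size c = m \<and> t + count_list c True = k} = {}" by auto
  moreover have "int_binomial (int m - (int k - int t)) (int k - int t) = 0"
    using False by (auto simp: int_binomial_def)
  ultimately show ?thesis by (simp only: card.empty finite.emptyI simp_thms)
qed

theorem theorem3p5:
  fixes n k :: nat
  assumes "n \<ge> 1"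
  shows "card {p \<in> Av n B1. card (inversions p) = k} =
    (\<Sum>l = 1..n. int_binomial (int n - int l - (int k - int (l choose 2)))
                              (int k - int (l choose 2)))"
proof -
  let ?C = "\<lambda>l. {c. layers_size c = n - l \<and> (l choose 2) + count_list c True = k}"
  have "{p \<in> Av n B1. card (inversions p) = k}
      = (\<lambda>(l, c). layered l c) ` (SIGMA l:{1..n}. ?C l)"
    unfolding Av_B1_eq[OF assms] by (force simp: card_inversions_layered)
  moreover have "inj_on (\<lambda>(l, c). layered l c) (SIGMA l:{1..n}. ?C l)"
    using layered_inject by (fastforce simp: inj_on_def)
  ultimately have "card {p \<in> Av n B1. card (inversions p) = k} = card (SIGMA l:{1..n}. ?C l)"
    by (simp only: card_image)
  also have "\<dots> = (\<Sum>l = 1..n. card (?C l))"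
    using card_layers_of_size by (intro card_SigmaI) auto
  also have "\<dots> = (\<Sum>l = 1..n. int_binomial (int n - int l - (int k - int (l choose 2)))
                              (int k - int (l choose 2)))"
    \<comment> \<open>In the range of summation \<open>l <= n\<close>, so \<open>int (n - l)\<close>
      is the untruncated \<open>int n - int l\<close>.\<close>
    by (intro sum.cong refl) (simp add: card_layers_of_size of_nat_diff)
  finally show ?thesis .
qed

end
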